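(* Let $(\breve N,\breve g,\breve J)$ be a metallic semi-Riemannian manifold. There does not exist a screen transversal anti-invariant lightlike submanifold $\acute N$ of $\breve N$ which is co-isotropic, and there does not exist a screen transversal anti-invariant lightlike submanifold $\acute N$ of $\breve N$ which is totally lightlike.
   Context: Fix positive integers $p,q$. A metallic semi-Riemannian manifold $(\breve N,\breve g,\breve J)$ is a semi-Riemannian manifold $(\breve N,\breve g)$ with a $(1,1)$-tensor field $\breve J$ such that $\breve J^2=p\breve J+qI$ and $\breve g(\breve JW,U)=\breve g(W,\breve JU)$ for all vector fields $W,U$ on $\breve N$. A submanifold $\acute N$ of dimension $m$ and codimension $k$ in $\breve N$ is lightlike if the metric $g$ induced from $\breve g$ is degenerate and the radical distribution $Rad(T\acute N)=T\acute N\cap T\acute N^{\perp}$ is a distribution of constant rank $r$ with $1\le r\le m$. It is equipped with a screen distribution $S(T\acute N)$ (a non-degenerate complement of $Rad(T\acute N)$ in $T\acute N$) and a screen transversal bundle $S(T\acute N^{\perp})$ (a non-degenerate complement of $Rad(T\acute N)$ in $T\acute N^{\perp}$). The lightlike submanifold is co-isotropic if $r=k<m$ (so $S(T\acute N^\perp)=\{0\}$), and totally lightlike if $r=k=m$ (so $S(T\acute N)=\{0\}=S(T\acute N^{\perp})$). $\acute N$ is a screen transversal lightlike submanifold if $\breve J\,Rad(T\acute N)\subset S(T\acute N^{\perp})$; it is screen transversal anti-invariant if moreover $\breve J\,S(T\acute N)\subset S(T\acute N^{\perp})$. *)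

theory Defs
  imports "HOL-Analysis.Analysis" "HOL-Library.Function_Algebras"
begin

text \<open>
  Pointwise real vector space structure on functions.  Tangent vectors below are functions,
  and this makes the library notions \<^const>\<open>subspace\<close>, \<^const>\<open>span\<close>, \<^const>\<open>dim\<close> apply to them.
\<close>

instantiation "fun" :: (type, real_vector) real_vector
begin

definition scaleR_fun :: "real \<Rightarrow> ('a \<Rightarrow> 'b) \<Rightarrow> 'a \<Rightarrow> 'b"
  where "scaleR_fun c f = (\<lambda>x. c *\<^sub>R f x)"

instance
  by standard (simp_all add: scaleR_fun_def plus_fun_def fun_eq_iff algebra_simps)

end


section \<open>Smooth maps between Euclidean spaces\<close>

text \<open>Both notions are meant for open \<open>S\<close>; the values of \<open>f\<close> outside \<open>S\<close> are irrelevant then.\<close>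

primrec C_k_on :: "nat \<Rightarrow> ('a::euclidean_space \<Rightarrow> 'b::real_normed_vector) \<Rightarrow> 'a set \<Rightarrow> bool" where
  "C_k_on 0 f S \<longleftrightarrow> continuous_on S f"
| "C_k_on (Suc k) f S \<longleftrightarrow>
     (\<forall>x\<in>S. f differentiable (at x)) \<and> (\<forall>v. C_k_on k (\<lambda>x. frechet_derivative f (at x) v) S)"

definition smooth_on :: "'a set \<Rightarrow> ('a::euclidean_space \<Rightarrow> 'b::real_normed_vector) \<Rightarrow> bool"
  where "smooth_on S f \<longleftrightarrow> (\<forall>k. C_k_on k f S)"


section \<open>Smooth manifolds and tangent spaces\<close>

text \<open>A chart is a domain together with a coordinate map, of which only the values on the domain matter.\<close>

type_synonym ('a, 'e) chart = "'a set \<times> ('a \<Rightarrow> 'e)"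

abbreviation chart_inv :: "('a, 'e) chart \<Rightarrow> 'e \<Rightarrow> 'a"
  where "chart_inv c \<equiv> inv_into (fst c) (snd c)"

record ('a, 'e) mfd =
  mfd_top :: "'a topology"
  atlas :: "('a, 'e) chart set"

abbreviation points :: "('a, 'e) mfd \<Rightarrow> 'a set"
  where "points M \<equiv> topspace (mfd_top M)"

abbreviation charts_at :: "('a, 'e) mfd \<Rightarrow> 'a \<Rightarrow> ('a, 'e) chart set"
  where "charts_at M x \<equiv> {c \<in> atlas M. x \<in> fst c}"

definition mfd_dim :: "('a, 'e::euclidean_space) mfd \<Rightarrow> nat"
  where "mfd_dim M = DIM('e)"

text \<open>The atlas is not required to be maximal.  Manifolds are non-empty.\<close>

definition smooth_manifold :: "('a, 'e::euclidean_space) mfd \<Rightarrow> bool" where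
  "smooth_manifold M \<longleftrightarrow>
     points M \<noteq> {} \<and> Hausdorff_space (mfd_top M) \<and> second_countable (mfd_top M) \<and>
     \<Union> (fst ` atlas M) = points M \<and>
     (\<forall>c\<in>atlas M. openin (mfd_top M) (fst c) \<and> open (snd c ` fst c) \<and>
        homeomorphic_map (subtopology (mfd_top M) (fst c)) (top_of_set (snd c ` fst c)) (snd c)) \<and>
     (\<forall>c\<in>atlas M. \<forall>d\<in>atlas M. smooth_on (snd c ` (fst c \<inter> fst d)) (snd d \<circ> chart_inv c))"

text \<open>
  A tangent vector at \<open>x\<close> is a family of component vectors, one for every chart around \<open>x\<close>, that
  transforms by the Jacobians of the coordinate changes; at all other charts its value is \<open>0\<close>,
  which makes the representing function unique.
\<close>

type_synonym ('a, 'e) tvec = "('a, 'e) chart \<Rightarrow> 'e"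

definition tangent_space :: "('a, 'e::euclidean_space) mfd \<Rightarrow> 'a \<Rightarrow> ('a, 'e) tvec set" where
  "tangent_space M x =
     {v. (\<forall>c. c \<notin> charts_at M x \<longrightarrow> v c = 0) \<and>
         (\<forall>c\<in>charts_at M x. \<forall>d\<in>charts_at M x.
            v d = frechet_derivative (snd d \<circ> chart_inv c) (at (snd c x)) (v c))}"

text \<open>The tangent vector at \<open>x\<close> whose components in the chart \<open>c\<close> are \<open>a\<close>.\<close>

definition coord_vec ::
  "('a, 'e::euclidean_space) mfd \<Rightarrow> ('a, 'e) chart \<Rightarrow> 'a \<Rightarrow> 'e \<Rightarrow> ('a, 'e) tvec" where
  "coord_vec M c x a =
     (\<lambda>d. if d \<in> charts_at M x
          then frechet_derivative (snd d \<circ> chart_inv c) (at (snd c x)) a else 0)"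

definition smooth_map ::
  "('b, 'f::euclidean_space) mfd \<Rightarrow> ('a, 'e::euclidean_space) mfd \<Rightarrow> ('b \<Rightarrow> 'a) \<Rightarrow> bool" where
  "smooth_map N M f \<longleftrightarrow>
     continuous_map (mfd_top N) (mfd_top M) f \<and>
     (\<forall>c\<in>atlas N. \<forall>d\<in>atlas M.
        smooth_on (snd c ` (fst c \<inter> f -` fst d)) (snd d \<circ> f \<circ> chart_inv c))"

text \<open>The choice of the chart \<open>c\<close> does not affect the result on tangent vectors.\<close>

definition differential ::
  "('b, 'f::euclidean_space) mfd \<Rightarrow> ('a, 'e::euclidean_space) mfd \<Rightarrow> ('b \<Rightarrow> 'a) \<Rightarrow> 'b
     \<Rightarrow> ('b, 'f) tvec \<Rightarrow> ('a, 'e) tvec" where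
  "differential N M f x v =
     (let c = (SOME c. c \<in> charts_at N x) in
      (\<lambda>d. if d \<in> charts_at M (f x)
           then frechet_derivative (snd d \<circ> f \<circ> chart_inv c) (at (snd c x)) (v c) else 0))"

text \<open>
  (Immersed) submanifolds: the points of \<open>N\<close> are points of \<open>M\<close>, and the inclusion is a smooth
  immersion.  The topology of \<open>N\<close> may be finer than the subspace topology.
\<close>

definition submanifold ::
  "('a, 'f::euclidean_space) mfd \<Rightarrow> ('a, 'e::euclidean_space) mfd \<Rightarrow> bool" where
  "submanifold N M \<longleftrightarrow>
     smooth_manifold N \<and> points N \<subseteq> points M \<and> smooth_map N M (\<lambda>x. x) \<and>
     (\<forall>x\<in>points N. inj_on (differential N M (\<lambda>x. x) x) (tangent_space N x))"

definition codim ::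
  "('a, 'f::euclidean_space) mfd \<Rightarrow> ('a, 'e::euclidean_space) mfd \<Rightarrow> nat"
  where "codim N M = mfd_dim M - mfd_dim N"

text \<open>
  Smooth sections over \<open>U\<close> of the restriction of the tangent bundle of \<open>M\<close> to the submanifold \<open>N\<close>;
  for \<open>N = M\<close> these are the smooth vector fields on \<open>U\<close>.
\<close>

definition smooth_section ::
  "('a, 'f::euclidean_space) mfd \<Rightarrow> ('a, 'e::euclidean_space) mfd \<Rightarrow> 'a set
     \<Rightarrow> ('a \<Rightarrow> ('a, 'e) tvec) \<Rightarrow> bool" where
  "smooth_section N M U V \<longleftrightarrow>
     (\<forall>x\<in>U. V x \<in> tangent_space M x) \<and>
     (\<forall>c\<in>atlas N. \<forall>d\<in>atlas M.
        smooth_on (snd c ` (U \<inter> fst c \<inter> fst d)) (\<lambda>y. V (chart_inv c y) d))"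

abbreviation smooth_vector_field ::
  "('a, 'e::euclidean_space) mfd \<Rightarrow> ('a \<Rightarrow> ('a, 'e) tvec) \<Rightarrow> bool"
  where "smooth_vector_field M V \<equiv> smooth_section M M (points M) V"

text \<open>Smooth rank-\<open>r\<close> subbundles of the restriction of the tangent bundle of \<open>M\<close> to \<open>N\<close>, given by their fibres.\<close>

definition smooth_subbundle ::
  "('a, 'f::euclidean_space) mfd \<Rightarrow> ('a, 'e::euclidean_space) mfd \<Rightarrow> nat
     \<Rightarrow> ('a \<Rightarrow> ('a, 'e) tvec set) \<Rightarrow> bool" where
  "smooth_subbundle N M r E \<longleftrightarrow>
     (\<forall>x\<in>points N. subspace (E x) \<and> E x \<subseteq> tangent_space M x \<and> dim (E x) = r) \<and>
     (\<forall>x\<in>points N. \<exists>U V. openin (mfd_top N) U \<and> x \<in> U \<and>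
        (\<forall>i<r. smooth_section N M U (V i)) \<and>
        (\<forall>y\<in>U. E y = span ((\<lambda>i. V i y) ` {..<r})))"


section \<open>Metallic semi-Riemannian manifolds\<close>

definition linear_endo_on :: "'v::real_vector set \<Rightarrow> ('v \<Rightarrow> 'v) \<Rightarrow> bool" where
  "linear_endo_on W f \<longleftrightarrow>
     f ` W \<subseteq> W \<and> (\<forall>u\<in>W. \<forall>v\<in>W. f (u + v) = f u + f v) \<and> (\<forall>a. \<forall>v\<in>W. f (a *\<^sub>R v) = a *\<^sub>R f v)"

definition symmetric_bilinear_on :: "'v::real_vector set \<Rightarrow> ('v \<Rightarrow> 'v \<Rightarrow> real) \<Rightarrow> bool" where
  "symmetric_bilinear_on W b \<longleftrightarrow>
     (\<forall>u\<in>W. \<forall>v\<in>W. b u v = b v u) \<and>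
     (\<forall>u\<in>W. \<forall>v\<in>W. \<forall>w\<in>W. b (u + v) w = b u w + b v w) \<and>
     (\<forall>a. \<forall>v\<in>W. \<forall>w\<in>W. b (a *\<^sub>R v) w = a * b v w)"

definition nondegenerate_on :: "'v::real_vector set \<Rightarrow> ('v \<Rightarrow> 'v \<Rightarrow> real) \<Rightarrow> bool" where
  "nondegenerate_on W b \<longleftrightarrow> (\<forall>v\<in>W. (\<forall>w\<in>W. b v w = 0) \<longrightarrow> v = 0)"

definition form_index :: "'v::real_vector set \<Rightarrow> ('v \<Rightarrow> 'v \<Rightarrow> real) \<Rightarrow> nat" where
  "form_index W b =
     Max (dim ` {P. subspace P \<and> P \<subseteq> W \<and> (\<forall>v\<in>P. v \<noteq> 0 \<longrightarrow> b v v < 0)})"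

type_synonym ('a, 'e) metric = "'a \<Rightarrow> ('a, 'e) tvec \<Rightarrow> ('a, 'e) tvec \<Rightarrow> real"
type_synonym ('a, 'e) endo = "'a \<Rightarrow> ('a, 'e) tvec \<Rightarrow> ('a, 'e) tvec"

definition semi_Riemannian_manifold ::
  "('a, 'e::euclidean_space) mfd \<Rightarrow> ('a, 'e) metric \<Rightarrow> bool" where
  "semi_Riemannian_manifold M g \<longleftrightarrow>
     smooth_manifold M \<and>
     (\<forall>x\<in>points M. symmetric_bilinear_on (tangent_space M x) (g x) \<and>
        nondegenerate_on (tangent_space M x) (g x)) \<and>
     (\<exists>\<nu>. \<forall>x\<in>points M. form_index (tangent_space M x) (g x) = \<nu>) \<and>
     (\<forall>c\<in>atlas M. \<forall>a b. smooth_on (snd c ` fst c)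
        (\<lambda>y. g (chart_inv c y) (coord_vec M c (chart_inv c y) a) (coord_vec M c (chart_inv c y) b)))"

definition smooth_endo_field ::
  "('a, 'e::euclidean_space) mfd \<Rightarrow> ('a, 'e) endo \<Rightarrow> bool" where
  "smooth_endo_field M J \<longleftrightarrow>
     (\<forall>x\<in>points M. linear_endo_on (tangent_space M x) (J x)) \<and>
     (\<forall>c\<in>atlas M. \<forall>a. smooth_on (snd c ` fst c)
        (\<lambda>y. J (chart_inv c y) (coord_vec M c (chart_inv c y) a) c))"

definition metallic_semi_Riemannian_manifold ::
  "nat \<Rightarrow> nat \<Rightarrow> ('a, 'e::euclidean_space) mfd \<Rightarrow> ('a, 'e) metric \<Rightarrow> ('a, 'e) endo \<Rightarrow> bool" where
  "metallic_semi_Riemannian_manifold p q M g J \<longleftrightarrow>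
     semi_Riemannian_manifold M g \<and> smooth_endo_field M J \<and>
     (\<forall>x\<in>points M. \<forall>v\<in>tangent_space M x. J x (J x v) = real p *\<^sub>R J x v + real q *\<^sub>R v) \<and>
     (\<forall>W U. smooth_vector_field M W \<longrightarrow> smooth_vector_field M U \<longrightarrow>
        (\<forall>x\<in>points M. g x (J x (W x)) (U x) = g x (W x) (J x (U x))))"


section \<open>Lightlike submanifolds\<close>

definition tangent_along ::
  "('a, 'e::euclidean_space) mfd \<Rightarrow> ('a, 'f::euclidean_space) mfd \<Rightarrow> 'a \<Rightarrow> ('a, 'e) tvec set"
  where "tangent_along M N x = differential N M (\<lambda>x. x) x ` tangent_space N x"

definition normal_space ::
  "('a, 'e::euclidean_space) mfd \<Rightarrow> ('a, 'e) metric \<Rightarrow> ('a, 'f::euclidean_space) mfd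
     \<Rightarrow> 'a \<Rightarrow> ('a, 'e) tvec set"
  where "normal_space M g N x = {v \<in> tangent_space M x. \<forall>w\<in>tangent_along M N x. g x v w = 0}"

definition radical ::
  "('a, 'e::euclidean_space) mfd \<Rightarrow> ('a, 'e) metric \<Rightarrow> ('a, 'f::euclidean_space) mfd
     \<Rightarrow> 'a \<Rightarrow> ('a, 'e) tvec set"
  where "radical M g N x = tangent_along M N x \<inter> normal_space M g N x"

definition complement_in :: "'v::real_vector set \<Rightarrow> 'v set \<Rightarrow> 'v set \<Rightarrow> bool" where
  "complement_in V R W \<longleftrightarrow>
     subspace W \<and> W \<subseteq> V \<and> R \<inter> W = {0} \<and> {u + w | u w. u \<in> R \<and> w \<in> W} = V"

definition screen_distribution ::
  "('a, 'e::euclidean_space) mfd \<Rightarrow> ('a, 'e) metric \<Rightarrow> ('a, 'f::euclidean_space) mfd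
     \<Rightarrow> ('a \<Rightarrow> ('a, 'e) tvec set) \<Rightarrow> bool" where
  "screen_distribution M g N S \<longleftrightarrow>
     (\<exists>s. smooth_subbundle N M s S) \<and>
     (\<forall>x\<in>points N. complement_in (tangent_along M N x) (radical M g N x) (S x) \<and>
        nondegenerate_on (S x) (g x))"

definition screen_transversal_bundle ::
  "('a, 'e::euclidean_space) mfd \<Rightarrow> ('a, 'e) metric \<Rightarrow> ('a, 'f::euclidean_space) mfd
     \<Rightarrow> ('a \<Rightarrow> ('a, 'e) tvec set) \<Rightarrow> bool" where
  "screen_transversal_bundle M g N T \<longleftrightarrow>
     (\<exists>s. smooth_subbundle N M s T) \<and>
     (\<forall>x\<in>points N. complement_in (normal_space M g N x) (radical M g N x) (T x) \<and>
        nondegenerate_on (T x) (g x))"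

text \<open>\<open>r\<close> is the rank of the radical distribution, \<open>S\<close> the screen distribution and \<open>T\<close> the screen transversal bundle.\<close>

definition lightlike_submanifold ::
  "('a, 'e::euclidean_space) mfd \<Rightarrow> ('a, 'e) metric \<Rightarrow> ('a, 'f::euclidean_space) mfd \<Rightarrow> nat
     \<Rightarrow> ('a \<Rightarrow> ('a, 'e) tvec set) \<Rightarrow> ('a \<Rightarrow> ('a, 'e) tvec set) \<Rightarrow> bool" where
  "lightlike_submanifold M g N r S T \<longleftrightarrow>
     submanifold N M \<and>
     (\<forall>x\<in>points N. \<not> nondegenerate_on (tangent_along M N x) (g x)) \<and>
     smooth_subbundle N M r (radical M g N) \<and> 1 \<le> r \<and> r \<le> mfd_dim N \<and>
     screen_distribution M g N S \<and> screen_transversal_bundle M g N T"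

definition co_isotropic ::
  "('a, 'e::euclidean_space) mfd \<Rightarrow> ('a, 'e) metric \<Rightarrow> ('a, 'f::euclidean_space) mfd \<Rightarrow> nat
     \<Rightarrow> ('a \<Rightarrow> ('a, 'e) tvec set) \<Rightarrow> ('a \<Rightarrow> ('a, 'e) tvec set) \<Rightarrow> bool" where
  "co_isotropic M g N r S T \<longleftrightarrow>
     lightlike_submanifold M g N r S T \<and> r = codim N M \<and> codim N M < mfd_dim N"

definition totally_lightlike ::
  "('a, 'e::euclidean_space) mfd \<Rightarrow> ('a, 'e) metric \<Rightarrow> ('a, 'f::euclidean_space) mfd \<Rightarrow> nat
     \<Rightarrow> ('a \<Rightarrow> ('a, 'e) tvec set) \<Rightarrow> ('a \<Rightarrow> ('a, 'e) tvec set) \<Rightarrow> bool" where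
  "totally_lightlike M g N r S T \<longleftrightarrow>
     lightlike_submanifold M g N r S T \<and> r = codim N M \<and> codim N M = mfd_dim N"

definition screen_transversal_lightlike ::
  "('a, 'e::euclidean_space) mfd \<Rightarrow> ('a, 'e) metric \<Rightarrow> ('a, 'e) endo
     \<Rightarrow> ('a, 'f::euclidean_space) mfd \<Rightarrow> nat
     \<Rightarrow> ('a \<Rightarrow> ('a, 'e) tvec set) \<Rightarrow> ('a \<Rightarrow> ('a, 'e) tvec set) \<Rightarrow> bool" where
  "screen_transversal_lightlike M g J N r S T \<longleftrightarrow>
     lightlike_submanifold M g N r S T \<and> (\<forall>x\<in>points N. J x ` radical M g N x \<subseteq> T x)"

definition screen_transversal_anti_invariant ::
  "('a, 'e::euclidean_space) mfd \<Rightarrow> ('a, 'e) metric \<Rightarrow> ('a, 'e) endo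
     \<Rightarrow> ('a, 'f::euclidean_space) mfd \<Rightarrow> nat
     \<Rightarrow> ('a \<Rightarrow> ('a, 'e) tvec set) \<Rightarrow> ('a \<Rightarrow> ('a, 'e) tvec set) \<Rightarrow> bool" where
  "screen_transversal_anti_invariant M g J N r S T \<longleftrightarrow>
     screen_transversal_lightlike M g J N r S T \<and> (\<forall>x\<in>points N. J x ` S x \<subseteq> T x)"

end

theory Submission
  imports Defs
begin

text \<open>
  Suppose that the radical distribution of a lightlike submanifold \<open>N\<close> has rank equal to the
  codimension of \<open>N\<close>; both co-isotropic and totally lightlike submanifolds are of this kind.
  Since the metric is non-degenerate on \<open>T\<^sub>xM\<close>, the normal space of \<open>N\<close> at \<open>x\<close> has dimension at most
  the codimension, and it contains the radical; hence the two agree (\<open>normal_space_eq_radical\<close>).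
  The screen transversal bundle is a complement of the radical in the normal space, so it
  vanishes.  If the metallic structure \<open>J\<close> maps the radical into it, then \<open>J v = 0\<close> for a non-zero
  radical vector \<open>v\<close>, and \<open>0 = J\<^sup>2 v = p J v + q v = q v\<close> gives a contradiction.

  The dimension count needs to know that \<open>T\<^sub>xN\<close> has the full dimension of \<open>N\<close>.  This rests on the
  isomorphism \<^const>\<open>coord_vec\<close> between the Euclidean model space and the tangent space, which is the
  chain rule for coordinate changes.  The linear algebra is then done in the model space, in a
  fixed chart.
\<close>

section \<open>Tangent spaces in coordinates\<close>

lemma smooth_on_differentiable:
  assumes "smooth_on S f" and "y \<in> S"
  shows "f differentiable (at y)"
proof -
  have "C_k_on (Suc 0) f S"
    using assms(1) unfolding smooth_on_def by blast
  then show ?thesis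
    using assms(2) by simp
qed

context
  fixes M :: "('a, 'e::euclidean_space) mfd" and x :: 'a
  assumes smooth: "smooth_manifold M"
begin

lemma chart_inj_on:
  assumes "c \<in> atlas M"
  shows "inj_on (snd c) (fst c)"
proof -
  have "fst c \<subseteq> points M"
    using smooth assms unfolding smooth_manifold_def by (auto dest: openin_subset)
  moreover have "homeomorphic_map (subtopology (mfd_top M) (fst c)) (top_of_set (snd c ` fst c)) (snd c)"
    using smooth assms unfolding smooth_manifold_def by blast
  ultimately show ?thesis
    using homeomorphic_imp_injective_map by (fastforce simp: Int_absorb1)
qed

lemma open_chart_overlap:
  assumes "c \<in> atlas M" and "d \<in> atlas M"
  shows "open (snd c ` (fst c \<inter> fst d))"
proof -
  have o: "openin (mfd_top M) (fst c)" "openin (mfd_top M) (fst d)" "open (snd c ` fst c)"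
    and "homeomorphic_map (subtopology (mfd_top M) (fst c)) (top_of_set (snd c ` fst c)) (snd c)"
    using smooth assms unfolding smooth_manifold_def by blast+
  then have "open_map (subtopology (mfd_top M) (fst c)) (top_of_set (snd c ` fst c)) (snd c)"
    using homeomorphic_imp_open_map by blast
  moreover have "openin (subtopology (mfd_top M) (fst c)) (fst c \<inter> fst d)"
    using o by (simp add: openin_subtopology_Int2)
  ultimately have "openin (top_of_set (snd c ` fst c)) (snd c ` (fst c \<inter> fst d))"
    unfolding open_map_def by blast
  then show ?thesis
    using o(3) by (simp add: openin_open_eq)
qed

lemma differentiable_transition:
  assumes "c \<in> charts_at M x" and "d \<in> charts_at M x"
  shows "(snd d \<circ> chart_inv c) differentiable (at (snd c x))"
proof (rule smooth_on_differentiable)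
  show "smooth_on (snd c ` (fst c \<inter> fst d)) (snd d \<circ> chart_inv c)"
    using smooth assms unfolding smooth_manifold_def by blast
  show "snd c x \<in> snd c ` (fst c \<inter> fst d)"
    using assms by blast
qed

lemma frechet_derivative_transition_self:
  assumes "c \<in> charts_at M x"
  shows "frechet_derivative (snd c \<circ> chart_inv c) (at (snd c x)) a = a"
proof -
  have "((\<lambda>y. y) has_derivative (\<lambda>a. a)) (at (snd c x))"
    by (rule has_derivative_ident)
  then have "(snd c \<circ> chart_inv c has_derivative (\<lambda>a. a)) (at (snd c x))"
  proof (rule has_derivative_transform_within_open)
    show "open (snd c ` (fst c \<inter> fst c))"
      using assms open_chart_overlap by blast
    show "snd c x \<in> snd c ` (fst c \<inter> fst c)"
      using assms by blast
  qed (simp add: f_inv_into_f)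
  then show ?thesis
    by (metis frechet_derivative_at)
qed

lemma frechet_derivative_transition_compose:
  assumes c: "c \<in> charts_at M x" and d: "d \<in> charts_at M x" and e: "e \<in> charts_at M x"
  shows "frechet_derivative (snd e \<circ> chart_inv c) (at (snd c x)) a =
    frechet_derivative (snd e \<circ> chart_inv d) (at (snd d x))
      (frechet_derivative (snd d \<circ> chart_inv c) (at (snd c x)) a)"
proof -
  let ?f = "snd d \<circ> chart_inv c" and ?g = "snd e \<circ> chart_inv d"
  have inj: "inj_on (snd c) (fst c)" "inj_on (snd d) (fst d)"
    using c d chart_inj_on by blast+
  have fx: "?f (snd c x) = snd d x"
    using c inj by simp
  have "(?f has_derivative frechet_derivative ?f (at (snd c x))) (at (snd c x))"
    using differentiable_transition[OF c d] frechet_derivative_works by blast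
  moreover have "(?g has_derivative frechet_derivative ?g (at (snd d x))) (at (?f (snd c x)))"
    using differentiable_transition[OF d e] frechet_derivative_works fx by metis
  ultimately have "(?g \<circ> ?f has_derivative
      frechet_derivative ?g (at (snd d x)) \<circ> frechet_derivative ?f (at (snd c x))) (at (snd c x))"
    by (rule diff_chain_at)
  then have "(snd e \<circ> chart_inv c has_derivative
      frechet_derivative ?g (at (snd d x)) \<circ> frechet_derivative ?f (at (snd c x))) (at (snd c x))"
  proof (rule has_derivative_transform_within_open)
    show "open (snd c ` (fst c \<inter> fst d))"
      using c d open_chart_overlap by blast
    show "snd c x \<in> snd c ` (fst c \<inter> fst d)"
      using c d by blast
  qed (use inj in auto)
  then show ?thesis
    by (metis comp_apply frechet_derivative_at)
qed

text \<open>
  The next lemmas show that \<^term>\<open>coord_vec M c x\<close> is a linear isomorphism from the model space onto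
  the tangent space at \<open>x\<close>, with inverse \<^term>\<open>\<lambda>v. v c\<close>.
\<close>

lemma coord_vec_in_tangent_space:
  assumes "c \<in> charts_at M x"
  shows "coord_vec M c x a \<in> tangent_space M x"
  unfolding tangent_space_def
proof (intro CollectI conjI allI ballI impI)
  fix d assume "d \<notin> charts_at M x"
  then show "coord_vec M c x a d = 0"
    unfolding coord_vec_def by (rule if_not_P)
next
  fix d e assume d: "d \<in> charts_at M x" and e: "e \<in> charts_at M x"
  show "coord_vec M c x a e =
      frechet_derivative (snd e \<circ> chart_inv d) (at (snd d x)) (coord_vec M c x a d)"
    unfolding coord_vec_def if_P[OF d] if_P[OF e]
    by (rule frechet_derivative_transition_compose[OF assms d e])
qed

lemma coord_vec_same_chart:
  assumes "c \<in> charts_at M x"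
  shows "coord_vec M c x a c = a"
  using assms frechet_derivative_transition_self by (simp add: coord_vec_def)

lemma coord_vec_of_tangent_vector:
  assumes "c \<in> charts_at M x" and "v \<in> tangent_space M x"
  shows "coord_vec M c x (v c) = v"
proof
  fix d
  have "d \<notin> charts_at M x \<Longrightarrow> v d = 0"
    and "d \<in> charts_at M x \<Longrightarrow>
      v d = frechet_derivative (snd d \<circ> chart_inv c) (at (snd c x)) (v c)"
    using assms unfolding tangent_space_def by blast+
  then show "coord_vec M c x (v c) d = v d"
    unfolding coord_vec_def by presburger
qed

lemma tangent_space_eq_range_coord_vec:
  assumes "c \<in> charts_at M x"
  shows "tangent_space M x = range (coord_vec M c x)"
proof (intro equalityI subsetI)
  fix v assume "v \<in> tangent_space M x"
  then show "v \<in> range (coord_vec M c x)"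
    using coord_vec_of_tangent_vector[OF assms] by (metis rangeI)
next
  fix v assume "v \<in> range (coord_vec M c x)"
  then show "v \<in> tangent_space M x"
    using coord_vec_in_tangent_space[OF assms] by blast
qed

lemma linear_coord_vec:
  assumes "c \<in> charts_at M x"
  shows "linear (coord_vec M c x)"
proof -
  have "linear (frechet_derivative (snd d \<circ> chart_inv c) (at (snd c x)))" if "d \<in> charts_at M x" for d
    using differentiable_transition[OF assms that] by (rule linear_frechet_derivative)
  then show ?thesis
    by (intro linearI) (auto simp: coord_vec_def fun_eq_iff scaleR_fun_def linear_add linear_scale)
qed

lemma subspace_tangent_space:
  assumes "c \<in> charts_at M x"
  shows "subspace (tangent_space M x)"
  unfolding tangent_space_eq_range_coord_vec[OF assms]
  using linear_coord_vec[OF assms] subspace_UNIV by (rule linear_subspace_image)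

end

lemma charts_at_nonempty:
  assumes "smooth_manifold M" and "x \<in> points M"
  shows "charts_at M x \<noteq> {}"
proof -
  have "x \<in> \<Union> (fst ` atlas M)"
    using assms unfolding smooth_manifold_def by blast
  then show ?thesis
    by auto
qed

lemma linear_component: "linear (\<lambda>v. v c)"
  by (intro linearI) (auto simp: scaleR_fun_def)


section \<open>Dimension of orthogonal complements\<close>

text \<open>The bilinear form need not be symmetric or definite.\<close>

lemma dim_orthogonal_nondegenerate:
  fixes b :: "'e::euclidean_space \<Rightarrow> 'e \<Rightarrow> real"
  assumes b: "bilinear b" and nondeg: "\<And>v. (\<And>w. b v w = 0) \<Longrightarrow> v = 0" and W: "subspace W"
  shows "subspace {v. \<forall>w\<in>W. b v w = 0}"
    and "dim {v. \<forall>w\<in>W. b v w = 0} + dim W \<le> DIM('e)"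
proof -
  let ?P = "{v. \<forall>w\<in>W. b v w = 0}"
  \<comment> \<open>\<open>A\<close> represents \<open>b\<close> through the inner product; being injective, it embeds the
    \<open>b\<close>-orthogonal space of \<open>W\<close> into the Euclidean orthogonal complement of \<open>W\<close>.\<close>
  show P: "subspace ?P"
    using b by (auto simp: subspace_def bilinear_lzero bilinear_ladd bilinear_lmul)
  define A where "A v = (\<Sum>i\<in>Basis. b v i *\<^sub>R i)" for v
  have A: "A v \<bullet> w = b v w" for v w
  proof -
    have "b v w = b v (\<Sum>i\<in>Basis. (w \<bullet> i) *\<^sub>R i)"
      by (simp add: euclidean_representation)
    also have "\<dots> = (\<Sum>i\<in>Basis. (w \<bullet> i) * b v i)"
      using b by (simp add: bilinear_def linear_sum linear_scale)
    also have "\<dots> = A v \<bullet> w"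
      by (simp add: A_def inner_sum_left inner_sum_right inner_commute mult.commute)
    finally show ?thesis by simp
  qed
  have lin: "linear A"
    using b by (intro linearI)
      (simp_all add: A_def bilinear_ladd bilinear_lmul scaleR_add_left sum.distrib scaleR_sum_right)
  have "inj A"
    using lin nondeg A by (metis inner_zero_left linear_injective_0)
  then have "dim ?P = dim (A ` ?P)"
    using dim_image_eq[OF lin inj_on_subset[OF _ subset_UNIV]] by simp
  also have "\<dots> \<le> dim {y \<in> UNIV. \<forall>w\<in>W. orthogonal w y}"
    by (intro dim_subset) (auto simp: orthogonal_def A inner_commute[of _ "A _"])
  finally show "dim ?P + dim W \<le> DIM('e)"
    using dim_subspace_orthogonal_to_vectors[OF W subspace_UNIV] by simp
qed


section \<open>Lightlike submanifolds\<close>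

text \<open>
  The components of the tangent vectors of \<open>N\<close> in a chart of \<open>M\<close> fill a subspace of the model space of
  \<open>M\<close>, of the dimension of \<open>N\<close>.
\<close>

lemma tangent_along_in_chart:
  fixes M :: "('a, 'e::euclidean_space) mfd" and N :: "('a, 'f::euclidean_space) mfd"
  assumes sub: "submanifold N M" and M: "smooth_manifold M" and x: "x \<in> points N"
    and W: "tangent_along M N x \<subseteq> tangent_space M x" and d: "d \<in> charts_at M x"
  shows "subspace ((\<lambda>v. v d) ` tangent_along M N x)"
    and "dim ((\<lambda>v. v d) ` tangent_along M N x) = DIM('f)"
proof -
  \<comment> \<open>the chart of \<open>N\<close> in which \<^const>\<open>differential\<close> is computed\<close>
  define c where "c = (SOME c. c \<in> charts_at N x)"
  have N: "smooth_manifold N" and sm: "smooth_map N M (\<lambda>x. x)"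
    and inj: "inj_on (differential N M (\<lambda>x. x) x) (tangent_space N x)"
    using sub x unfolding submanifold_def by blast+
  have c: "c \<in> charts_at N x"
    unfolding c_def using charts_at_nonempty[OF N x, folded ex_in_conv] by (rule someI_ex)
  define h where "h = frechet_derivative (snd d \<circ> (\<lambda>x. x) \<circ> chart_inv c) (at (snd c x))"
  have "snd c x \<in> snd c ` (fst c \<inter> (\<lambda>x. x) -` fst d)"
    using c d by blast
  moreover have "smooth_on (snd c ` (fst c \<inter> (\<lambda>x. x) -` fst d)) (snd d \<circ> (\<lambda>x. x) \<circ> chart_inv c)"
    using c d sm unfolding smooth_map_def by blast
  ultimately have h: "linear h"
    unfolding h_def using linear_frechet_derivative smooth_on_differentiable by blast
  have diff: "differential N M (\<lambda>x. x) x (coord_vec N c x a) d = h a" for a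
    unfolding differential_def c_def[symmetric] h_def Let_def coord_vec_same_chart[OF N c]
    using d by presburger
  have T: "tangent_space N x = range (coord_vec N c x)"
    by (rule tangent_space_eq_range_coord_vec[OF N c])
  have im: "(\<lambda>v. v d) ` tangent_along M N x = range h"
    unfolding tangent_along_def T by (auto simp: image_image diff)
  show "subspace ((\<lambda>v. v d) ` tangent_along M N x)"
    unfolding im using h by (intro linear_subspace_image) auto
  have "inj h"
  proof (rule injI)
    fix a b assume "h a = h b"
    then have eq: "differential N M (\<lambda>x. x) x (coord_vec N c x a) d =
        differential N M (\<lambda>x. x) x (coord_vec N c x b) d"
      by (simp add: diff)
    have "differential N M (\<lambda>x. x) x (coord_vec N c x e) \<in> tangent_space M x" for e
      using W T unfolding tangent_along_def by blast
    then have "coord_vec M d x (differential N M (\<lambda>x. x) x (coord_vec N c x e) d) =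
        differential N M (\<lambda>x. x) x (coord_vec N c x e)" for e
      by (rule coord_vec_of_tangent_vector[OF M d])
    from this[of a] this[of b] have "differential N M (\<lambda>x. x) x (coord_vec N c x a) =
        differential N M (\<lambda>x. x) x (coord_vec N c x b)"
      unfolding eq by (rule trans[OF sym])
    then have "coord_vec N c x a = coord_vec N c x b"
      using inj T by (auto dest: inj_onD)
    then show "a = b"
      using coord_vec_same_chart[OF N c] by metis
  qed
  then show "dim ((\<lambda>v. v d) ` tangent_along M N x) = DIM('f)"
    unfolding im using dim_image_eq[OF h, of UNIV] by simp
qed

text \<open>
  A lightlike submanifold carries a screen distribution, and its tangent spaces are the sums of two
  subspaces of the tangent spaces of \<open>M\<close>.  So no computation with the differential is needed.
\<close>

lemma tangent_along_subset_tangent_space: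
  assumes M: "smooth_manifold M" and L: "lightlike_submanifold M g N r S T" and x: "x \<in> points N"
  shows "tangent_along M N x \<subseteq> tangent_space M x"
proof
  fix v assume v: "v \<in> tangent_along M N x"
  have "x \<in> points M"
    using L x unfolding lightlike_submanifold_def submanifold_def by blast
  then obtain c where c: "c \<in> charts_at M x"
    using charts_at_nonempty[OF M] by blast
  have "complement_in (tangent_along M N x) (radical M g N x) (S x)" and S: "S x \<subseteq> tangent_space M x"
    using L x unfolding lightlike_submanifold_def screen_distribution_def smooth_subbundle_def by blast+
  then obtain u w where "v = u + w" "u \<in> radical M g N x" "w \<in> S x"
    using v unfolding complement_in_def by blast
  then show "v \<in> tangent_space M x"
    using S subspace_add[OF subspace_tangent_space[OF M c]]
    by (auto simp: radical_def normal_space_def)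
qed

lemma normal_space_eq_radical:
  fixes M :: "('a, 'e::euclidean_space) mfd" and N :: "('a, 'f::euclidean_space) mfd"
  assumes M: "semi_Riemannian_manifold M g" and L: "lightlike_submanifold M g N r S T"
    and r: "r = codim N M" and x: "x \<in> points N"
  shows "normal_space M g N x = radical M g N x"
proof -
  let ?V = "tangent_space M x" and ?W = "tangent_along M N x"
    and ?R = "radical M g N x" and ?P = "normal_space M g N x"
  have sm: "smooth_manifold M"
    using M unfolding semi_Riemannian_manifold_def by blast
  have sub: "submanifold N M" and xM: "x \<in> points M"
    and R: "subspace ?R" "dim ?R = r" "1 \<le> r"
    using L x unfolding lightlike_submanifold_def smooth_subbundle_def submanifold_def by blast+
  have W: "?W \<subseteq> ?V"
    using tangent_along_subset_tangent_space[OF sm L x] .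
  have g: "symmetric_bilinear_on ?V (g x)" "nondegenerate_on ?V (g x)"
    using M xM unfolding semi_Riemannian_manifold_def by blast+
  obtain d where d: "d \<in> charts_at M x"
    using charts_at_nonempty[OF sm xM] by blast
  let ?k = "coord_vec M d x" and ?e = "\<lambda>v::('a, 'e) tvec. v d"
  note kV = coord_vec_in_tangent_space[OF sm d] and ek = coord_vec_same_chart[OF sm d]
    and ke = coord_vec_of_tangent_vector[OF sm d] and k = linear_coord_vec[OF sm d]
  \<comment> \<open>the metric at \<open>x\<close>, transported to the model space\<close>
  define b where "b u w = g x (?k u) (?k w)" for u w
  have "bilinear b"
    unfolding bilinear_def b_def
  proof (intro conjI allI linearI)
    fix u v w :: 'e and a :: real
    have add: "g x (?k (v + w)) (?k u) = g x (?k v) (?k u) + g x (?k w) (?k u)" for u v w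
      using g(1) kV k by (simp add: symmetric_bilinear_on_def linear_add)
    have scale: "g x (?k (a *\<^sub>R v)) (?k u) = a *\<^sub>R g x (?k v) (?k u)" for u v a
      using g(1) kV k by (simp add: symmetric_bilinear_on_def linear_scale)
    have sym: "g x (?k v) (?k u) = g x (?k u) (?k v)" for u v
      using g(1) kV by (simp add: symmetric_bilinear_on_def)
    show "g x (?k (v + w)) (?k u) = g x (?k v) (?k u) + g x (?k w) (?k u)"
      "g x (?k (a *\<^sub>R v)) (?k u) = a *\<^sub>R g x (?k v) (?k u)"
      by (fact add scale)+
    show "g x (?k u) (?k (v + w)) = g x (?k u) (?k v) + g x (?k u) (?k w)"
      "g x (?k u) (?k (a *\<^sub>R v)) = a *\<^sub>R g x (?k u) (?k v)"
      unfolding sym[of u] by (fact add scale)+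
  qed
  moreover have "v = 0" if "\<And>w. b v w = 0" for v
  proof -
    have "g x (?k v) w = 0" if "w \<in> ?V" for w
      using \<open>\<And>w. b v w = 0\<close>[of "w d"] ke[OF that] by (simp add: b_def)
    then have "?k v = 0"
      using g(2) kV unfolding nondegenerate_on_def by blast
    then show "v = 0"
      using ek[of v] by simp
  qed
  moreover note Wc = tangent_along_in_chart[OF sub sm x W d]
  ultimately have P': "subspace {v. \<forall>w\<in>?e ` ?W. b v w = 0}"
    "dim {v. \<forall>w\<in>?e ` ?W. b v w = 0} + DIM('f) \<le> DIM('e)"
    using dim_orthogonal_nondegenerate[of b "?e ` ?W"] by auto
  have P: "?e ` ?P = {v. \<forall>w\<in>?e ` ?W. b v w = 0}"
  proof (intro set_eqI iffI)
    fix v assume "v \<in> ?e ` ?P"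
    then show "v \<in> {v. \<forall>w\<in>?e ` ?W. b v w = 0}"
      using W ke by (auto simp: b_def normal_space_def subset_iff)
  next
    fix v assume v: "v \<in> {v. \<forall>w\<in>?e ` ?W. b v w = 0}"
    then have "?k v \<in> ?P"
      using W kV ke by (auto simp: b_def normal_space_def subset_iff)
    then show "v \<in> ?e ` ?P"
      using ek[of v] by (metis imageI)
  qed
  have "subspace (?e ` ?R)"
    using linear_component R(1) by (rule linear_subspace_image)
  moreover have RP: "?R \<subseteq> ?P"
    by (auto simp: radical_def)
  moreover have "dim (?e ` ?P) \<le> dim (?e ` ?R)"
  proof -
    \<comment> \<open>Tangent vectors are functions, so the ambient vector space may have infinite dimension; a
      basis of the image of the radical in the model space is carried back to bound \<^term>\<open>dim ?R\<close>.\<close>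
    obtain B where B: "B \<subseteq> ?e ` ?R" "independent B" "?e ` ?R \<subseteq> span B" "card B = dim (?e ` ?R)"
      using basis_exists[of "?e ` ?R"] by blast
    have "?R \<subseteq> span (?k ` B)"
    proof
      fix v assume v: "v \<in> ?R"
      then have "?k (v d) \<in> ?k ` span B"
        using B(3) by blast
      moreover have "?k (v d) = v"
        using v by (intro ke) (auto simp: radical_def normal_space_def)
      ultimately show "v \<in> span (?k ` B)"
        using linear_span_image[OF k] by metis
    qed
    moreover have "finite B"
      using B(2) independent_imp_finite by blast
    ultimately have "dim ?R \<le> card (?k ` B)"
      by (intro dim_le_card) auto
    also have "\<dots> \<le> dim (?e ` ?R)"
      using \<open>finite B\<close> B(4) card_image_le by metis
    finally show ?thesis
      using P'(2) R(2,3) r unfolding P codim_def mfd_dim_def by linarith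
  qed
  ultimately have eq: "?e ` ?R = ?e ` ?P"
    using P' P by (intro subspace_dim_equal) auto
  show ?thesis
  proof (intro equalityI RP subsetI)
    fix v assume v: "v \<in> ?P"
    then have "v d \<in> ?e ` ?R"
      unfolding eq by (rule imageI)
    then obtain u where "u \<in> ?R" "v d = u d"
      by blast
    moreover have "v \<in> ?V" "u \<in> ?V"
      using v \<open>u \<in> ?R\<close> by (auto simp: radical_def normal_space_def)
    ultimately have "?k (v d) = v" "?k (u d) = u"
      by (blast intro: ke)+
    then have "v = u"
      unfolding \<open>v d = u d\<close> by (rule trans[OF sym])
    with \<open>u \<in> ?R\<close> show "v \<in> ?R"
      by simp
  qed
qed

lemma metallic_structure_injective:
  assumes M: "metallic_semi_Riemannian_manifold p q M g J" and q: "q > 0" and x: "x \<in> points M"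
    and v: "v \<in> tangent_space M x" "J x v = 0"
  shows "v = 0"
proof -
  have "linear_endo_on (tangent_space M x) (J x)"
    and eq: "J x (J x v) = real p *\<^sub>R J x v + real q *\<^sub>R v"
    using M x v unfolding metallic_semi_Riemannian_manifold_def smooth_endo_field_def by blast+
  then have "J x (0 *\<^sub>R v) = 0 *\<^sub>R J x v"
    using v(1) unfolding linear_endo_on_def by blast
  then show ?thesis
    using eq v(2) q by simp
qed

lemma no_screen_transversal_lightlike_of_maximal_rank:
  assumes M: "metallic_semi_Riemannian_manifold p q M g J" and q: "q > 0"
    and N: "screen_transversal_lightlike M g J N r S T"
  shows "r \<noteq> codim N M"
proof
  assume r: "r = codim N M"
  have L: "lightlike_submanifold M g N r S T"
    using N unfolding screen_transversal_lightlike_def by blast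
  then have sub: "submanifold N M"
    unfolding lightlike_submanifold_def by blast
  then obtain x where x: "x \<in> points N"
    unfolding submanifold_def smooth_manifold_def by blast
  have xM: "x \<in> points M"
    using sub x unfolding submanifold_def by blast
  have "dim (radical M g N x) \<ge> 1"
    using L x unfolding lightlike_submanifold_def smooth_subbundle_def by auto
  moreover have "dim (radical M g N x) \<le> card {}" if "radical M g N x \<subseteq> {0}"
    using that dim_le_card[of _ "{}"] by simp
  ultimately obtain v where v: "v \<in> radical M g N x" "v \<noteq> 0"
    by fastforce
  have "T x \<subseteq> normal_space M g N x" "radical M g N x \<inter> T x = {0}"
    using L x unfolding lightlike_submanifold_def screen_transversal_bundle_def complement_in_def
    by blast+
  then have "T x \<subseteq> {0}"
    using normal_space_eq_radical[OF _ L r x] M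
    unfolding metallic_semi_Riemannian_manifold_def by blast
  then have "J x v = 0"
    using N x v(1) unfolding screen_transversal_lightlike_def by blast
  then show False
    using metallic_structure_injective[OF M q xM] v by (auto simp: radical_def normal_space_def)
qed

theorem proposition3p7:
  fixes p q :: nat
    and M :: "('a, 'e::euclidean_space) mfd"
    and g :: "('a, 'e) metric"
    and J :: "('a, 'e) endo"
  assumes "p > 0" and "q > 0"
    and "metallic_semi_Riemannian_manifold p q M g J"
  shows "\<not> (\<exists>(N :: ('a, 'f::euclidean_space) mfd) r S T.
             screen_transversal_anti_invariant M g J N r S T \<and> co_isotropic M g N r S T) \<and>
         \<not> (\<exists>(N :: ('a, 'f) mfd) r S T.
             screen_transversal_anti_invariant M g J N r S T \<and> totally_lightlike M g N r S T)"
proof -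
  have "r \<noteq> codim N M" if "screen_transversal_anti_invariant M g J N r S T"
    for N :: "('a, 'f) mfd" and r S T
    using that no_screen_transversal_lightlike_of_maximal_rank[OF assms(3,2)]
    unfolding screen_transversal_anti_invariant_def by blast
  then show ?thesis
    unfolding co_isotropic_def totally_lightlike_def by blast
qed

end
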